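(* Let $B$ be an atomless Boolean contact algebra satisfying - the interpolation axiom: $x\ll y\Rightarrow \exists z\,(x\ll z\wedge z\ll y)$; - the connectedness axiom: $x\notin\{0,1\}\Rightarrow x\mathrel{C}-x$; - axiom (G1): for every $x\in B$ with $x\neq 0$ there is a G-representative $Q$ with $x\in Q$; - axiom (G2): if $x\mathrel{C}y$, then there is a G-representative $Q$ such that $u\cdot x\neq 0$ and $u\cdot y\neq 0$ for all $u\in Q$. Suppose $\mathbf{Grz}^\omega(B)\neq\emptyset$. Let $\langle \mathbf{Grz}(B),\mathscr{O}\rangle$ be the topological space of all G-points of $B$, and let $\mathscr{O}^\omega=\{\mathbf{Grz}^\omega(B)\cap V\mid V\in\mathscr{O}\}$. Then the subspace $\langle \mathbf{Grz}^\omega(B),\mathscr{O}^\omega\rangle$ is a topological space whose points are W-points: every element of $\mathbf{Grz}^\omega(B)$ is of the form $\{y\in B\mid \exists x\in A\ x\leq y\}$ for some W-representative $A$ of $B$.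
   Context: A Boolean contact algebra is a Boolean algebra $B$ (operations $\cdot,+,-$, constants $0,1$, order $\leq$) with a binary relation $C$ (contact) such that for all $x,y,z\in B$: (C0) not $0\mathrel{C}x$; (C1) $x\leq y\wedge x\neq 0\Rightarrow x\mathrel{C}y$; (C2) $x\mathrel{C}y\Rightarrow y\mathrel{C}x$; (C3) $x\leq y\Rightarrow \forall z\,(z\mathrel{C}x\Rightarrow z\mathrel{C}y)$; (C4) $x\mathrel{C}(y+z)\Rightarrow x\mathrel{C}y\vee x\mathrel{C}z$. Non-tangential inclusion is defined by: $x\ll y$ iff not $x\mathrel{C}(-y)$. A G-representative (Grzegorczyk representative of a point) in $B$ is a non-empty set $Q\subseteq B$ such that: (r0) $0\notin Q$; (r1) for all $u,v\in Q$: $u=v$ or $u\ll v$ or $v\ll u$; (r2) for every $u\in Q$ there is $v\in Q$ with $v\ll u$; (r3) for all $x,y\in B$: if $u\cdot x\neq 0$ and $u\cdot y\neq 0$ for all $u\in Q$, then $x\mathrel{C}y$. A G-point (Grzegorczyk point) of $B$ is a filter generated by a G-representative $Q$, i.e. a set $\{y\in B\mid \exists x\in Q\ x\leq y\}$. The set of all G-points is $\mathbf{Grz}(B)$. It carries the topology $\mathscr{O}$ with basis consisting of the sets $\{\mathscr{G}\in\mathbf{Grz}(B)\mid x\in\mathscr{G}\}$, $x\in B$. An abstractive set in $B$ is a set $A\subseteq B$ satisfying (r0) and (r1) (with $A$ in place of $Q$) and having no minimum, i.e. there is no $x\in A$ with $x\leq y$ for all $y\in A$. For $A_1,A_2\subseteq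 B$, $A_1$ covers $A_2$ ($A_1\succeq A_2$) iff for every $x\in A_1$ there is $y\in A_2$ with $y\leq x$. Abstractive sets $A_1,A_2$ are similar, $A_1\sim A_2$, iff $A_1\succeq A_2$ and $A_2\succeq A_1$. Put $[A_1]\trianglerighteq[A_2]$ iff $A_1\succeq A_2$ (a partial order on $\sim$-classes). A W-point (Whitehead point) is a class $[A]$ such that for every abstractive $A'$, $[A]\trianglerighteq[A']$ implies $[A]=[A']$. A W-representative is an abstractive set $A$ such that $[A]$ is a W-point; equivalently, for every abstractive $A'$, $A\succeq A'$ implies $A'\succeq A$. Since two abstractive sets are similar iff they generate the same upward closed set, a W-point $[A]$ is identified with $\{y\in B\mid\exists x\in A\ x\leq y\}$, in the same way that G-points correspond to classes of G-representatives under mutual covering. $\mathbf{Grz}^\omega(B)$ is the set of those G-points generated by some G-representative $Q$ for which there is a countable abstractive set $A'$ with $Q\succeq A'$ and $A'\succeq Q$. *)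

theory Defs
  imports "HOL-Analysis.Analysis"
begin

text \<open>
  The Boolean algebra \<open>B\<close> is the whole carrier of a type of class \<open>boolean_algebra\<close>; the lattice
  operations \<open>inf\<close>, \<open>sup\<close>, \<open>uminus\<close>, \<open>bot\<close>, \<open>top\<close> stand for \<open>\<cdot>\<close>, \<open>+\<close>, \<open>-\<close>, \<open>0\<close>, \<open>1\<close>.
\<close>

locale boolean_contact_algebra =
  fixes C :: "'a::boolean_algebra \<Rightarrow> 'a \<Rightarrow> bool"
  assumes C0: "\<not> C bot x"
    and C1: "x \<le> y \<Longrightarrow> x \<noteq> bot \<Longrightarrow> C x y"
    and C2: "C x y \<Longrightarrow> C y x"
    and C3: "x \<le> y \<Longrightarrow> C z x \<Longrightarrow> C z y"
    and C4: "C x (sup y z) \<Longrightarrow> C x y \<or> C x z"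

definition atom :: "'a::boolean_algebra \<Rightarrow> bool" where
  "atom a \<longleftrightarrow> a \<noteq> bot \<and> (\<forall>x. x \<le> a \<longrightarrow> x = bot \<or> x = a)"

definition nt_incl :: "('a::boolean_algebra \<Rightarrow> 'a \<Rightarrow> bool) \<Rightarrow> 'a \<Rightarrow> 'a \<Rightarrow> bool" where
  "nt_incl C x y \<longleftrightarrow> \<not> C x (- y)"

definition upset :: "'a::order set \<Rightarrow> 'a set" where
  "upset Q = {y. \<exists>x\<in>Q. x \<le> y}"

definition covers :: "'a::order set \<Rightarrow> 'a set \<Rightarrow> bool" where
  "covers A1 A2 \<longleftrightarrow> (\<forall>x\<in>A1. \<exists>y\<in>A2. y \<le> x)"

definition r0 :: "'a::boolean_algebra set \<Rightarrow> bool" where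
  "r0 Q \<longleftrightarrow> bot \<notin> Q"

definition r1 :: "('a::boolean_algebra \<Rightarrow> 'a \<Rightarrow> bool) \<Rightarrow> 'a set \<Rightarrow> bool" where
  "r1 C Q \<longleftrightarrow> (\<forall>u\<in>Q. \<forall>v\<in>Q. u = v \<or> nt_incl C u v \<or> nt_incl C v u)"

definition r2 :: "('a::boolean_algebra \<Rightarrow> 'a \<Rightarrow> bool) \<Rightarrow> 'a set \<Rightarrow> bool" where
  "r2 C Q \<longleftrightarrow> (\<forall>u\<in>Q. \<exists>v\<in>Q. nt_incl C v u)"

definition r3 :: "('a::boolean_algebra \<Rightarrow> 'a \<Rightarrow> bool) \<Rightarrow> 'a set \<Rightarrow> bool" where
  "r3 C Q \<longleftrightarrow> (\<forall>x y. (\<forall>u\<in>Q. inf u x \<noteq> bot \<and> inf u y \<noteq> bot) \<longrightarrow> C x y)"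

definition G_representative :: "('a::boolean_algebra \<Rightarrow> 'a \<Rightarrow> bool) \<Rightarrow> 'a set \<Rightarrow> bool" where
  "G_representative C Q \<longleftrightarrow> Q \<noteq> {} \<and> r0 Q \<and> r1 C Q \<and> r2 C Q \<and> r3 C Q"

definition Grz :: "('a::boolean_algebra \<Rightarrow> 'a \<Rightarrow> bool) \<Rightarrow> 'a set set" where
  "Grz C = {upset Q |Q. G_representative C Q}"

definition grz_basic :: "('a::boolean_algebra \<Rightarrow> 'a \<Rightarrow> bool) \<Rightarrow> 'a \<Rightarrow> 'a set set" where
  "grz_basic C x = {G \<in> Grz C. x \<in> G}"

text \<open>
  \<open>topology\<close> yields an unspecified value unless its argument satisfies \<open>istopology\<close>; the lemma
  \<open>openin_grz_topology\<close> below shows that it does for every contact algebra.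
\<close>

definition grz_topology :: "('a::boolean_algebra \<Rightarrow> 'a \<Rightarrow> bool) \<Rightarrow> 'a set topology" where
  "grz_topology C = topology (arbitrary union_of (\<lambda>U. U \<in> range (grz_basic C)))"

text \<open>
  The empty set counts as abstractive here. No nonempty set covers it, so it plays no role
  for G-representatives or for nonempty abstractive sets.
\<close>

definition abstractive :: "('a::boolean_algebra \<Rightarrow> 'a \<Rightarrow> bool) \<Rightarrow> 'a set \<Rightarrow> bool" where
  "abstractive C A \<longleftrightarrow> r0 A \<and> r1 C A \<and> \<not> (\<exists>x\<in>A. \<forall>y\<in>A. x \<le> y)"

definition similar :: "('a::boolean_algebra \<Rightarrow> 'a \<Rightarrow> bool) \<Rightarrow> ('a set \<times> 'a set) set" where
  "similar C = {(A1, A2). abstractive C A1 \<and> abstractive C A2 \<and> covers A1 A2 \<and> covers A2 A1}"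

abbreviation sim_class :: "('a::boolean_algebra \<Rightarrow> 'a \<Rightarrow> bool) \<Rightarrow> 'a set \<Rightarrow> 'a set set" where
  "sim_class C A \<equiv> similar C `` {A}"

definition class_covers ::
  "('a::boolean_algebra \<Rightarrow> 'a \<Rightarrow> bool) \<Rightarrow> 'a set set \<Rightarrow> 'a set set \<Rightarrow> bool" where
  "class_covers C P1 P2 \<longleftrightarrow>
    (\<exists>A1 A2. abstractive C A1 \<and> abstractive C A2 \<and>
       P1 = sim_class C A1 \<and> P2 = sim_class C A2 \<and> covers A1 A2)"

definition W_point :: "('a::boolean_algebra \<Rightarrow> 'a \<Rightarrow> bool) \<Rightarrow> 'a set set \<Rightarrow> bool" where
  "W_point C P \<longleftrightarrow>
    (\<exists>A. abstractive C A \<and> P = sim_class C A) \<and>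
    (\<forall>A'. abstractive C A' \<longrightarrow> class_covers C P (sim_class C A') \<longrightarrow> P = sim_class C A')"

definition W_representative :: "('a::boolean_algebra \<Rightarrow> 'a \<Rightarrow> bool) \<Rightarrow> 'a set \<Rightarrow> bool" where
  "W_representative C A \<longleftrightarrow> abstractive C A \<and> W_point C (sim_class C A)"

text \<open>
  A W-point is a class of abstractive sets; it is identified with the common upward closure
  \<open>upset A\<close> of its members.
\<close>

definition Grz_omega :: "('a::boolean_algebra \<Rightarrow> 'a \<Rightarrow> bool) \<Rightarrow> 'a set set" where
  "Grz_omega C = {upset Q |Q. G_representative C Q \<and>
     (\<exists>A'. countable A' \<and> abstractive C A' \<and> covers Q A' \<and> covers A' Q)}"

definition omega_opens :: "('a::boolean_algebra \<Rightarrow> 'a \<Rightarrow> bool) \<Rightarrow> 'a set set set" where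
  "omega_opens C = {Grz_omega C \<inter> V |V. openin (grz_topology C) V}"

lemma covers_trans: "covers A1 A2 \<Longrightarrow> covers A2 A3 \<Longrightarrow> covers A1 A3"
  unfolding covers_def by (meson order_trans)

lemma covers_refl: "covers A A"
  unfolding covers_def by blast

lemma sim_class_eq_iff:
  assumes "abstractive C A1" "abstractive C A2"
  shows "sim_class C A1 = sim_class C A2 \<longleftrightarrow> covers A1 A2 \<and> covers A2 A1"
proof
  assume "sim_class C A1 = sim_class C A2"
  moreover have "A2 \<in> sim_class C A2"
    using assms by (simp add: similar_def covers_refl)
  ultimately have "A2 \<in> sim_class C A1" by simp
  then show "covers A1 A2 \<and> covers A2 A1"
    by (simp add: similar_def)
next
  assume "covers A1 A2 \<and> covers A2 A1"
  then show "sim_class C A1 = sim_class C A2"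
    using assms by (auto simp: similar_def intro: covers_trans)
qed

lemma class_covers_iff:
  assumes "abstractive C A1" "abstractive C A2"
  shows "class_covers C (sim_class C A1) (sim_class C A2) \<longleftrightarrow> covers A1 A2"
proof
  assume "class_covers C (sim_class C A1) (sim_class C A2)"
  then obtain B1 B2 where B: "abstractive C B1" "abstractive C B2"
    "sim_class C A1 = sim_class C B1" "sim_class C A2 = sim_class C B2" "covers B1 B2"
    unfolding class_covers_def by blast
  with assms have "covers A1 B1" "covers B2 A2"
    by (simp_all add: sim_class_eq_iff)
  with B(5) show "covers A1 A2"
    by (blast intro: covers_trans)
next
  assume "covers A1 A2"
  with assms show "class_covers C (sim_class C A1) (sim_class C A2)"
    unfolding class_covers_def by blast
qed

lemma W_representative_iff:
  "W_representative C A \<longleftrightarrow>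
     abstractive C A \<and> (\<forall>A'. abstractive C A' \<longrightarrow> covers A A' \<longrightarrow> covers A' A)"
proof (cases "abstractive C A")
  case True
  then have "W_point C (sim_class C A) \<longleftrightarrow>
      (\<forall>A'. abstractive C A' \<longrightarrow> covers A A' \<longrightarrow> sim_class C A = sim_class C A')"
    unfolding W_point_def using class_covers_iff by metis
  with True show ?thesis
    unfolding W_representative_def using sim_class_eq_iff by metis
qed (simp add: W_representative_def)

context boolean_contact_algebra
begin

lemma nt_incl_imp_le:
  assumes "nt_incl C x y" shows "x \<le> y"
proof (rule ccontr)
  assume "\<not> x \<le> y"
  then have "inf x (- y) \<noteq> bot"
    by (simp add: inf_shunt)
  then have "C (inf x (- y)) x"
    by (simp add: C1)
  then have "C (inf x (- y)) (- y)" "C x (inf x (- y))"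
    using \<open>inf x (- y) \<noteq> bot\<close> C1 C2 by auto
  then have "C x (- y)"
    using C3 inf_le2 by blast
  with assms show False
    by (simp add: nt_incl_def)
qed

lemma inf_mem_Grz:
  assumes "G \<in> Grz C"
  shows "inf x y \<in> G \<longleftrightarrow> x \<in> G \<and> y \<in> G"
proof -
  obtain Q where Q: "G = upset Q" "r1 C Q"
    using assms by (auto simp: Grz_def G_representative_def)
  have chain: "u \<le> v \<or> v \<le> u" if "u \<in> Q" "v \<in> Q" for u v
    using that Q(2) nt_incl_imp_le by (fastforce simp: r1_def)
  show ?thesis
  proof
    assume "x \<in> G \<and> y \<in> G"
    then obtain u v where "u \<in> Q" "v \<in> Q" "u \<le> x" "v \<le> y"
      by (auto simp: Q(1) upset_def)
    with chain[of u v] show "inf x y \<in> G"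
      unfolding Q(1) upset_def by (auto intro: order_trans)
  qed (auto simp: Q(1) upset_def)
qed

lemma openin_grz_topology:
  "openin (grz_topology C) = arbitrary union_of (\<lambda>U. U \<in> range (grz_basic C))"
proof -
  have "grz_basic C x \<inter> grz_basic C y = grz_basic C (inf x y)" for x y
    by (auto simp: grz_basic_def inf_mem_Grz)
  then have "istopology (arbitrary union_of (\<lambda>U. U \<in> range (grz_basic C)))"
    by (intro istopology_base) auto
  then show ?thesis
    by (simp add: grz_topology_def)
qed

lemma topspace_grz_topology: "topspace (grz_topology C) = Grz C"
proof
  have "top \<in> G" if "G \<in> Grz C" for G
    using that by (auto simp: Grz_def G_representative_def upset_def)
  then have "grz_basic C top = Grz C"
    by (auto simp: grz_basic_def)
  moreover have "openin (grz_topology C) (grz_basic C top)"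
    by (simp add: openin_grz_topology arbitrary_union_of_inc)
  ultimately show "Grz C \<subseteq> topspace (grz_topology C)"
    using openin_subset by metis
  have "\<And>U. openin (grz_topology C) U \<Longrightarrow> U \<subseteq> Grz C"
    by (auto simp: openin_grz_topology union_of_def grz_basic_def)
  then show "topspace (grz_topology C) \<subseteq> Grz C"
    by blast
qed

end

end

theory Submission
  imports Defs
begin

text \<open>
  A point of \<open>Grz_omega C\<close> comes with a G-representative \<open>Q\<close> and an abstractive set \<open>A\<close> covering
  one another. The set \<open>A\<close> itself is the required W-representative: it generates the same filter as
  \<open>Q\<close>, and it is minimal with respect to covering because of the axiom \<open>r3\<close>, which says that only
  regions in contact can both overlap every member of \<open>Q\<close>. Indeed, let \<open>A'\<close> be an abstractive set
  below \<open>A\<close>, and suppose that some \<open>a \<in> A'\<close> has no member of \<open>A\<close>, hence none of \<open>Q\<close>, below it. Then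
  every member of \<open>Q\<close> overlaps \<open>- a\<close>. As \<open>A'\<close> has no minimum, it contains some \<open>b\<close> that is
  non-tangentially included in \<open>a\<close>; as \<open>A'\<close> is a chain of nonzero regions below \<open>Q\<close>, every member of
  \<open>Q\<close> overlaps \<open>b\<close>. So \<open>r3\<close> puts \<open>b\<close> in contact with \<open>- a\<close>, against the choice of \<open>b\<close>. The
  lemma \<open>abstractive_covers_G_representative\<close> is this argument.

  The topological part amounts to recognising \<open>omega_opens C\<close> as the open sets of a subspace.
\<close>

lemma upset_eq_of_covers:
  assumes "covers A B" "covers B A"
  shows "upset A = upset B"
  using assms unfolding covers_def upset_def by (blast intro: order_trans)

context boolean_contact_algebra
begin

lemma r1_chain:
  assumes "r1 C A" "u \<in> A" "v \<in> A"
  shows "u \<le> v \<or> v \<le> u"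
  using assms nt_incl_imp_le order_refl unfolding r1_def by metis

lemma abstractive_nt_incl_below:
  assumes "abstractive C A" "a \<in> A"
  obtains b where "b \<in> A" "nt_incl C b a"
proof -
  obtain b where "b \<in> A" "\<not> a \<le> b"
    using assms unfolding abstractive_def by blast
  then have "nt_incl C b a"
    using assms nt_incl_imp_le order_refl unfolding abstractive_def r1_def by metis
  with \<open>b \<in> A\<close> that show thesis by blast
qed

lemma abstractive_overlaps_covering:
  assumes "abstractive C A" "covers Q A" "u \<in> Q" "b \<in> A"
  shows "inf u b \<noteq> bot"
proof -
  obtain c where c: "c \<in> A" "c \<le> u"
    using assms(2,3) unfolding covers_def by blast
  obtain d where d: "d \<in> A" "d \<le> b" "d \<le> c"
    using r1_chain[of A b c] assms(1,4) c(1) unfolding abstractive_def by blast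
  then have "d \<le> inf u b"
    using c(2) by auto
  moreover have "d \<noteq> bot"
    using assms(1) d(1) unfolding abstractive_def r0_def by blast
  ultimately show ?thesis
    using bot_unique by metis
qed

text \<open>
  An abstractive set cannot shrink strictly inside a Grzegorczyk point: two of its members in
  non-tangential inclusion would separate the point, which \<open>r3\<close> forbids.
\<close>

lemma abstractive_covers_G_representative:
  assumes "r3 C Q" "abstractive C A" "covers Q A"
  shows "covers A Q"
proof (rule ccontr)
  assume "\<not> covers A Q"
  then obtain a where a: "a \<in> A" "\<And>u. u \<in> Q \<Longrightarrow> \<not> u \<le> a"
    unfolding covers_def by blast
  obtain b where b: "b \<in> A" "nt_incl C b a"
    using abstractive_nt_incl_below assms(2) a(1) by blast
  have "inf u b \<noteq> bot \<and> inf u (- a) \<noteq> bot" if "u \<in> Q" for u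
    using abstractive_overlaps_covering assms(2,3) that b(1) a(2)[OF that]
    by (simp add: inf_shunt)
  then have "C b (- a)"
    using assms(1) unfolding r3_def by blast
  with b(2) show False
    by (simp add: nt_incl_def)
qed

lemma W_representative_of_similar_G_representative:
  assumes "G_representative C Q" "abstractive C A" "covers Q A" "covers A Q"
  shows "W_representative C A"
  unfolding W_representative_iff
proof (intro conjI allI impI)
  fix A' assume A': "abstractive C A'" "covers A A'"
  have "covers A' Q"
    using assms(1,3) A' abstractive_covers_G_representative covers_trans
    unfolding G_representative_def by blast
  then show "covers A' A"
    using assms(3) covers_trans by blast
qed (fact assms(2))

end

lemma Grz_omega_subset: "Grz_omega C \<subseteq> Grz C"
  unfolding Grz_omega_def Grz_def by blast

lemma omega_opens_eq_openin:
  "(\<lambda>U. U \<in> omega_opens C) = openin (subtopology (grz_topology C) (Grz_omega C))"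
  unfolding omega_opens_def by (auto simp: openin_subtopology fun_eq_iff)

theorem theorem3:
  fixes C :: "'a::boolean_algebra \<Rightarrow> 'a \<Rightarrow> bool"
  assumes "boolean_contact_algebra C"
    and atomless: "\<not> (\<exists>a::'a. atom a)"
    and interpolation: "\<And>x y. nt_incl C x y \<Longrightarrow> \<exists>z. nt_incl C x z \<and> nt_incl C z y"
    and connectedness: "\<And>x. x \<notin> {bot, top} \<Longrightarrow> C x (- x)"
    and G1: "\<And>x. x \<noteq> bot \<Longrightarrow> \<exists>Q. G_representative C Q \<and> x \<in> Q"
    and G2: "\<And>x y. C x y \<Longrightarrow>
        \<exists>Q. G_representative C Q \<and> (\<forall>u\<in>Q. inf u x \<noteq> bot \<and> inf u y \<noteq> bot)"
    and nonempty: "Grz_omega C \<noteq> {}"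
  shows "istopology (\<lambda>U. U \<in> omega_opens C) \<and>
    topology (\<lambda>U. U \<in> omega_opens C) = subtopology (grz_topology C) (Grz_omega C) \<and>
    topspace (topology (\<lambda>U. U \<in> omega_opens C)) = Grz_omega C \<and>
    (\<forall>G\<in>Grz_omega C. \<exists>A. W_representative C A \<and> G = upset A)"
proof -
  interpret boolean_contact_algebra C by fact
  have "topspace (subtopology (grz_topology C) (Grz_omega C)) = Grz_omega C"
    using Grz_omega_subset[of C] by (simp add: topspace_grz_topology Int_absorb1)
  moreover have "\<exists>A. W_representative C A \<and> G = upset A" if G: "G \<in> Grz_omega C" for G
  proof -
    obtain Q A where "G = upset Q" "G_representative C Q"
        "abstractive C A" "covers Q A" "covers A Q"
      using G unfolding Grz_omega_def by blast
    then show ?thesis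
      using W_representative_of_similar_G_representative upset_eq_of_covers by blast
  qed
  ultimately show ?thesis
    by (simp add: omega_opens_eq_openin openin_inverse)
qed

end
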